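(* Let $A,B,X$ be $n\times n$ complex matrices such that $A$ and $B$ are positive definite, with eigenvalues (counted with multiplicity) $\lambda_1,\dots,\lambda_n$ and $\mu_1,\dots,\mu_n$ respectively, and let $\nu\in(0,1)$. For every $t\in\mathbb{N}$, $t\ge1$, let $$\underline{K_t}=\min\Big\{K\big((\tfrac{\mu_j}{\lambda_i})^{\frac{1}{2^{t-1}}},2\big)^{r_t}: i,j=1,\dots,n\Big\},\qquad \overline{K_t}=\max\Big\{K\big((\tfrac{\mu_j}{\lambda_i})^{\frac{1}{2^{t-1}}},2\big)^{R_t}: i,j=1,\dots,n\Big\}.$$ Then for every integer $t\ge1$, $$\underline{K_t}\,\|A^{1-\nu}XB^{\nu}\|_2^2\;\le\;\|(1-\nu)AX+\nu XB\|_2^2-r_0^2\|AX-XB\|_2^2-\sum_{k=1}^{t-1}r_k\Big\|A^{1-\frac{m_k}{2^k}}XB^{\frac{m_k}{2^k}}-A^{1-\frac{m_k+1}{2^k}}XB^{\frac{m_k+1}{2^k}}\Big\|_2^2\;\le\;\overline{K_t}\,\|A^{1-\nu}XB^{\nu}\|_2^2.$$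
   Context: $\|\cdot\|_2$ is the Hilbert–Schmidt (Frobenius) norm. For $s>0$, $K(s,2)=\frac{(1+s)^2}{4s}$ (Kantorovich constant). For $\nu\in[0,1]$ and integers $k\ge 0$: $m_k=\lfloor 2^k\nu\rfloor$; $r_0=\min\{\nu,1-\nu\}$ and $r_k=\min\{2r_{k-1},1-2r_{k-1}\}$ for $k\ge 1$; $R_k=1-r_k$. An empty sum is $0$. *)

theory Defs
  imports "Jordan_Normal_Form.Schur_Decomposition"
begin

definition unitary_mat :: "complex mat \<Rightarrow> bool" where
  "unitary_mat U \<longleftrightarrow> square_mat U \<and> mat_adjoint U * U = 1\<^sub>m (dim_row U)"

definition positive_definite :: "complex mat \<Rightarrow> bool" where
  "positive_definite A \<longleftrightarrow> square_mat A \<and> mat_adjoint A = A \<and>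
     (\<forall>v \<in> carrier_vec (dim_row A). v \<noteq> 0\<^sub>v (dim_row A) \<longrightarrow> Re ((A *\<^sub>v v) \<bullet>c v) > 0)"

definition hilbert_schmidt_norm :: "complex mat \<Rightarrow> real" where
  "hilbert_schmidt_norm A = sqrt (\<Sum>i<dim_row A. \<Sum>j<dim_col A. (cmod (A $$ (i,j)))\<^sup>2)"

definition real_diag :: "nat \<Rightarrow> (nat \<Rightarrow> real) \<Rightarrow> complex mat" where
  "real_diag n d = mat_diag n (\<lambda>i. complex_of_real (d i))"

definition positive_spectral_decomp :: "complex mat \<Rightarrow> complex mat \<Rightarrow> (nat \<Rightarrow> real) \<Rightarrow> bool" where
  "positive_spectral_decomp A U d \<longleftrightarrow>
     U \<in> carrier_mat (dim_row A) (dim_row A) \<and> unitary_mat U \<and> (\<forall>i<dim_row A. d i > 0) \<and>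
     A = U * real_diag (dim_row A) d * mat_adjoint U"

(* The real power of a positive definite matrix, by functional calculus: if A = U diag(d) U* with
   U unitary, then A^s = U diag(d^s) U*. A decomposition exists by the spectral theorem, and the
   lemma mat_powr_eq below shows that the value does not depend on its choice. *)
definition mat_powr :: "complex mat \<Rightarrow> real \<Rightarrow> complex mat" where
  "mat_powr A s = (THE C. \<exists>U d. positive_spectral_decomp A U d \<and>
     C = U * real_diag (dim_row A) (\<lambda>i. d i powr s) * mat_adjoint U)"

lemma mat_adjoint_carrier:
  assumes "U \<in> carrier_mat n m"
  shows "mat_adjoint U \<in> carrier_mat m n"
  using assms unfolding mat_adjoint_def by auto

lemma real_diag_carrier [simp]: "real_diag n d \<in> carrier_mat n n"
  unfolding real_diag_def by simp

lemma unitary_mat_right: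
  assumes "U \<in> carrier_mat n n" "unitary_mat U"
  shows "mat_adjoint U * U = 1\<^sub>m n" "U * mat_adjoint U = 1\<^sub>m n"
proof -
  show 1: "mat_adjoint U * U = 1\<^sub>m n" using assms unfolding unitary_mat_def by auto
  show "U * mat_adjoint U = 1\<^sub>m n"
    using mat_mult_left_right_inverse[OF mat_adjoint_carrier[OF assms(1)] assms(1) 1] .
qed

lemma spectral_powr_unique:
  assumes UV: "positive_spectral_decomp A U d" "positive_spectral_decomp A V e"
  shows "U * real_diag (dim_row A) (\<lambda>i. d i powr s) * mat_adjoint U =
         V * real_diag (dim_row A) (\<lambda>i. e i powr s) * mat_adjoint V"
proof -
  define n where "n = dim_row A"
  define U' V' where "U' = mat_adjoint U" and "V' = mat_adjoint V"
  have c: "U \<in> carrier_mat n n" "V \<in> carrier_mat n n" "U' \<in> carrier_mat n n" "V' \<in> carrier_mat n n"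
    using UV mat_adjoint_carrier
    unfolding positive_spectral_decomp_def n_def U'_def V'_def by auto
  have u: "U' * U = 1\<^sub>m n" "U * U' = 1\<^sub>m n" "V' * V = 1\<^sub>m n" "V * V' = 1\<^sub>m n"
    using UV unitary_mat_right c
    unfolding positive_spectral_decomp_def U'_def V'_def by auto
  note ass = assoc_mult_mat[of _ n n _ n _ n]
  define W where "W = V' * U"
  have W: "W \<in> carrier_mat n n" using c unfolding W_def by auto
  have collapse: "V' * (U * D * U') * U = W * D" "V' * (V * D * V') * U = D * W"
    if D: "D \<in> carrier_mat n n" for D
  proof -
    have "V' * (U * D * U') * U = V' * U * D * (U' * U)"
      using c D by (simp add: ass)
    then show "V' * (U * D * U') * U = W * D" using c D u W unfolding W_def by simp
    have "V' * (V * D * V') * U = (V' * V) * D * (V' * U)"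
      using c D by (simp add: ass)
    then show "V' * (V * D * V') * U = D * W" using c D u W unfolding W_def by simp
  qed
  have "U * real_diag n d * U' = V * real_diag n e * V'"
    using UV unfolding positive_spectral_decomp_def n_def U'_def V'_def by metis
  then have eq: "W * real_diag n d = real_diag n e * W"
    using collapse by (metis real_diag_carrier)
  have entry: "W $$ (i,j) * complex_of_real (d j) = complex_of_real (e i) * W $$ (i,j)"
    if "i < n" "j < n" for i j
    using arg_cong[OF eq, of "\<lambda>M. M $$ (i,j)"] that
    unfolding real_diag_def mat_diag_mult_left[OF W] mat_diag_mult_right[OF W] by simp
  let ?f = "real_diag n (\<lambda>i. d i powr s)" and ?g = "real_diag n (\<lambda>i. e i powr s)"
  have eq': "W * ?f = ?g * W"
    unfolding real_diag_def mat_diag_mult_left[OF W] mat_diag_mult_right[OF W]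
  proof (rule eq_matI, goal_cases)
    case (1 i j)
    then have "W $$ (i,j) = 0 \<or> d j = e i" using entry[of i j] by auto
    then show ?case using 1 by auto
  qed auto
  have "U * ?f * U' = (V * V') * U * ?f * U'" using c u by simp
  also have "\<dots> = V * (W * ?f) * U'" using c unfolding W_def by (simp add: ass)
  also have "\<dots> = V * (?g * W) * U'" using eq' by simp
  also have "\<dots> = V * ?g * V' * (U * U')"
    using c unfolding W_def by (simp add: ass mult_carrier_mat[of _ n n _ n])
  also have "\<dots> = V * ?g * V'"
    using c u right_mult_one_mat[of "V * ?g * V'" n n] real_diag_carrier[of n] by simp
  finally show ?thesis unfolding n_def U'_def V'_def .
qed

lemma mat_powr_eq:
  assumes "positive_spectral_decomp A U d"
  shows "mat_powr A s = U * real_diag (dim_row A) (\<lambda>i. d i powr s) * mat_adjoint U"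
  unfolding mat_powr_def
  by (rule the_equality) (use assms spectral_powr_unique in blast)+

(* The Kantorovich constant K(s,2). *)
definition kantorovich2 :: "real \<Rightarrow> real" where
  "kantorovich2 s = (1 + s)\<^sup>2 / (4 * s)"

definition m_seq :: "real \<Rightarrow> nat \<Rightarrow> int" where
  "m_seq \<nu> k = \<lfloor>2 ^ k * \<nu>\<rfloor>"

primrec r_seq :: "real \<Rightarrow> nat \<Rightarrow> real" where
  "r_seq \<nu> 0 = min \<nu> (1 - \<nu>)"
| "r_seq \<nu> (Suc k) = min (2 * r_seq \<nu> k) (1 - 2 * r_seq \<nu> k)"

definition R_seq :: "real \<Rightarrow> nat \<Rightarrow> real" where
  "R_seq \<nu> k = 1 - r_seq \<nu> k"

definition K_lower :: "nat \<Rightarrow> (nat \<Rightarrow> real) \<Rightarrow> (nat \<Rightarrow> real) \<Rightarrow> real \<Rightarrow> nat \<Rightarrow> real" where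
  "K_lower n lam mu \<nu> t =
     Min {kantorovich2 ((mu j / lam i) powr (1 / 2 ^ (t - 1))) powr r_seq \<nu> t | i j. i < n \<and> j < n}"

definition K_upper :: "nat \<Rightarrow> (nat \<Rightarrow> real) \<Rightarrow> (nat \<Rightarrow> real) \<Rightarrow> real \<Rightarrow> nat \<Rightarrow> real" where
  "K_upper n lam mu \<nu> t =
     Max {kantorovich2 ((mu j / lam i) powr (1 / 2 ^ (t - 1))) powr R_seq \<nu> t | i j. i < n \<and> j < n}"

(* The eigenvalues of an n x n matrix, listed with (algebraic) multiplicity as ev 0, ..., ev (n-1). *)
definition eigenvalues_with_mult :: "nat \<Rightarrow> complex mat \<Rightarrow> (nat \<Rightarrow> real) \<Rightarrow> bool" where
  "eigenvalues_with_mult n A ev \<longleftrightarrow> char_poly A = (\<Prod>i<n. [:- complex_of_real (ev i), 1:])"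

end

theory Submission
  imports Defs "HOL-Analysis.Convex"
begin

text \<open>
  Diagonalise \<open>A = U diag(\<lambda>) U*\<close> and \<open>B = V diag(\<mu>) V*\<close>. In these coordinates every matrix in the
  statement is obtained from \<open>Y = U* X V\<close> by multiplying its \<open>(i,j)\<close> entry by a real function of
  \<open>a = \<lambda>\<^sub>i\<close> and \<open>b = \<mu>\<^sub>j\<close>, so that the claim is a sum over \<open>i, j\<close> of scalar inequalities weighted by
  \<open>|Y\<^sub>i\<^sub>j|\<^sup>2\<close>.

  In the scalar case the identity \<open>\<nu>(1 - \<nu>) + r\<^sub>0\<^sup>2 = r\<^sub>0\<close> turns the first two terms into
  \<open>(1 - \<nu>) a\<^sup>2 + \<nu> b\<^sup>2 - r\<^sub>0 (a - b)\<^sup>2\<close>. Each subtracted square then replaces a weighted mean of two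
  neighbouring points of the geodesic \<open>a^(2(1-s)) b^(2s)\<close> on the grid of step \<open>1/2\<^sup>k\<close> by one on the grid of half
  the step, with weight the fractional part of \<open>2\<^sup>k \<nu>\<close>. What is left after \<open>t\<close> steps is a weighted
  arithmetic mean, which is compared with the geometric mean via Young's inequality for one of the
  endpoints and the midpoint: this is where the Kantorovich constant enters.
\<close>

section \<open>Scalar inequalities\<close>

lemma powr_square: "(x powr s)\<^sup>2 = x powr (2 * s)" for x s :: real
  using powr_add[of x s s] by (simp add: power2_eq_square)

section \<open>Young's inequality refined by the Kantorovich constant\<close>

lemma kantorovich2_div:
  assumes "a > 0" "b > 0"
  shows "kantorovich2 (b / a) = ((a + b) / 2)\<^sup>2 / (a * b)"
  using assms unfolding kantorovich2_def by (simp add: field_simps power2_eq_square)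

lemma kantorovich2_div_commute:
  assumes "a > 0" "b > 0"
  shows "kantorovich2 (a / b) = kantorovich2 (b / a)"
  using assms by (simp add: kantorovich2_div add.commute mult.commute)

text \<open>The constant is the squared ratio of the arithmetic to the geometric mean of
  \<open>a\<close> and \<open>b\<close>. Splitting its power into factors in the midpoint,
  \<open>a\<close> and \<open>b\<close> makes the cancellations in the next two lemmas
  visible.\<close>

lemma kantorovich2_div_powr:
  assumes "a > 0" "b > 0"
  shows "kantorovich2 (b / a) powr w = ((a + b) / 2) powr (2 * w) * a powr (- w) * b powr (- w)"
proof -
  define m where "m = (a + b) / 2"
  have m: "m > 0" using assms unfolding m_def by simp
  have "kantorovich2 (b / a) powr w = (m * m / (a * b)) powr w"
    using assms by (simp add: kantorovich2_div m_def power2_eq_square)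
  also have "\<dots> = m powr (2 * w) * a powr (- w) * b powr (- w)"
    using assms m powr_add[of m w w] by (simp add: powr_divide powr_mult powr_minus divide_simps)
  finally show ?thesis unfolding m_def .
qed

text \<open>The powers of \<open>b\<close> cancel and leave
  \<open>m powr (2 * w) * a powr (1 - 2 * w)\<close> with \<open>m\<close> the midpoint. This is
  Young's inequality for \<open>m\<close> and \<open>a\<close>; \<open>w \<le> 1/2\<close> keeps the
  second weight nonnegative.\<close>

lemma young_kantorovich_lower_half:
  assumes "a > 0" "b > 0" "0 \<le> w" "w \<le> 1/2"
  shows "kantorovich2 (b / a) powr w * (a powr (1 - w) * b powr w) \<le> (1 - w) * a + w * b"
proof -
  define m where "m = (a + b) / 2"
  have m: "m > 0" using assms unfolding m_def by simp
  have "kantorovich2 (b / a) powr w * (a powr (1 - w) * b powr w)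
      = m powr (2 * w) * (a powr (- w) * a powr (1 - w)) * (b powr (- w) * b powr w)"
    using assms by (simp add: kantorovich2_div_powr m_def ac_simps)
  also have "\<dots> = m powr (2 * w) * a powr (1 - 2 * w)"
    using assms by (simp flip: powr_add)
  also have "\<dots> \<le> 2 * w * m + (1 - 2 * w) * a"
    using Youngs_inequality_0[of "2 * w" "1 - 2 * w" m a] assms m by simp
  also have "\<dots> = (1 - w) * a + w * b" unfolding m_def by (simp add: field_simps)
  finally show ?thesis .
qed

text \<open>Here the powers of \<open>a\<close> cancel, and the right side becomes
  \<open>m powr (2 - 2 * w) * b powr (2 * w - 1)\<close>. For \<open>w \<le> 1/2\<close> the
  midpoint \<open>m\<close> lies between the mean \<open>c\<close> and \<open>b\<close>, so Young's
  inequality for \<open>c\<close> and \<open>b\<close> bounds \<open>c\<close> from above.\<close>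

lemma young_kantorovich_upper_half:
  assumes "a > 0" "b > 0" "0 \<le> w" "w \<le> 1/2"
  shows "(1 - w) * a + w * b \<le> kantorovich2 (b / a) powr (1 - w) * (a powr (1 - w) * b powr w)"
proof -
  define m where "m = (a + b) / 2"
  have m: "m > 0" using assms unfolding m_def by simp
  define c where "c = (1 - w) * a + w * b"
  have c: "c > 0" unfolding c_def using assms by (intro add_pos_nonneg) auto
  \<comment> \<open>The weight that writes \<open>m\<close> as a convex combination of
    \<open>c\<close> and \<open>b\<close>: it turns the coefficient \<open>1 - w\<close> of
    \<open>a\<close> in \<open>c\<close> into 1/2.\<close>
  define p where "p = 1 / (2 - 2 * w)"
  have p: "0 \<le> p" "p \<le> 1" "p * (2 - 2 * w) = 1" "(1 - p) * (2 - 2 * w) = 1 - 2 * w"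
    using assms unfolding p_def by (simp_all add: field_simps)
  have "p * c + (1 - p) * b = m"
    using assms unfolding p_def c_def m_def by (simp add: divide_simps) (simp add: algebra_simps)
  then have y: "c powr p * b powr (1 - p) \<le> m"
    using Youngs_inequality_0[of p "1 - p" c b] p c assms by simp
  have "c * b powr (1 - 2 * w) = (c powr p * b powr (1 - p)) powr (2 - 2 * w)"
    using p c assms by (simp add: powr_mult powr_powr)
  also have "\<dots> \<le> m powr (2 - 2 * w)"
    using y assms by (intro powr_mono2) auto
  finally have le: "c * b powr (1 - 2 * w) \<le> m powr (2 - 2 * w)" .
  have "c = c * b powr (1 - 2 * w) * b powr (2 * w - 1)"
    using assms by (simp add: mult.assoc flip: powr_add)
  also have "\<dots> \<le> m powr (2 - 2 * w) * b powr (2 * w - 1)"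
    using le by (intro mult_right_mono) auto
  also have "\<dots> = m powr (2 * (1 - w)) * (a powr (- (1 - w)) * a powr (1 - w))
      * (b powr (- (1 - w)) * b powr w)"
    using assms by (simp add: algebra_simps flip: powr_add)
  also have "\<dots> = kantorovich2 (b / a) powr (1 - w) * (a powr (1 - w) * b powr w)"
    using assms by (simp only: kantorovich2_div_powr m_def ac_simps)
  finally show ?thesis unfolding c_def .
qed

text \<open>For \<open>w > 1/2\<close>, exchange \<open>a\<close> with \<open>b\<close> and
  \<open>w\<close> with \<open>1 - w\<close>: both means and the Kantorovich constant are symmetric
  under this.\<close>

lemma young_kantorovich:
  assumes "a > 0" "b > 0" "0 \<le> w" "w \<le> 1"
  defines "r \<equiv> min w (1 - w)"
  shows "kantorovich2 (b / a) powr r * (a powr (1 - w) * b powr w) \<le> (1 - w) * a + w * b"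
    and "(1 - w) * a + w * b \<le> kantorovich2 (b / a) powr (1 - r) * (a powr (1 - w) * b powr w)"
proof -
  have sym: "kantorovich2 (a / b) = kantorovich2 (b / a)"
    using assms(1,2) by (rule kantorovich2_div_commute)
  have *: "kantorovich2 (b / a) powr r * (a powr (1 - w) * b powr w) \<le> (1 - w) * a + w * b \<and>
    (1 - w) * a + w * b \<le> kantorovich2 (b / a) powr (1 - r) * (a powr (1 - w) * b powr w)"
  proof (cases "w \<le> 1/2")
    case True
    then have "r = w" unfolding r_def by simp
    then show ?thesis
      using young_kantorovich_lower_half young_kantorovich_upper_half assms True by simp
  next
    case False
    then have "r = 1 - w" unfolding r_def by simp
    then show ?thesis
      using young_kantorovich_lower_half[of b a "1 - w"] young_kantorovich_upper_half[of b a "1 - w"]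
        assms(1-4) False by (simp add: sym ac_simps)
  qed
  then show "kantorovich2 (b / a) powr r * (a powr (1 - w) * b powr w) \<le> (1 - w) * a + w * b"
    and "(1 - w) * a + w * b \<le> kantorovich2 (b / a) powr (1 - r) * (a powr (1 - w) * b powr w)"
    by auto
qed

section \<open>Binary digits of \<nu> and the telescoping on dyadic grids\<close>

lemma m_seq_frac: "real_of_int (m_seq \<nu> k) = 2 ^ k * \<nu> - frac (2 ^ k * \<nu>)"
  unfolding m_seq_def frac_def by simp

lemma frac_double:
  fixes x :: real
  shows "frac (2 * x) = (if frac x < 1/2 then 2 * frac x else 2 * frac x - 1)"
proof -
  have "2 * x - 2 * frac x = of_int (2 * \<lfloor>x\<rfloor>)"
    "2 * x - (2 * frac x - 1) = of_int (2 * \<lfloor>x\<rfloor> + 1)"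
    by (simp_all add: frac_def)
  then have "2 * x - 2 * frac x \<in> \<int>" "2 * x - (2 * frac x - 1) \<in> \<int>"
    by (metis Ints_of_int)+
  then show ?thesis using frac_ge_0[of x] frac_lt_1[of x] by (auto simp: frac_unique_iff)
qed

text \<open>\<open>r_seq\<close> is an orbit of the tent map, while the fractional parts of
  \<open>2 ^ k * \<nu>\<close> form an orbit of the doubling map. The distance to the nearest
  integer carries the second map to the first.\<close>

lemma r_seq_frac:
  assumes "0 < \<nu>" "\<nu> < 1"
  shows "r_seq \<nu> k = min (frac (2 ^ k * \<nu>)) (1 - frac (2 ^ k * \<nu>))"
proof (induction k)
  case 0
  have "frac \<nu> = \<nu>" using assms by (simp add: frac_eq)
  then show ?case by simp
next
  case (Suc k)
  have "frac (2 ^ Suc k * \<nu>) = frac (2 * (2 ^ k * \<nu>))" by (simp add: mult.assoc)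
  then show ?case using Suc frac_lt_1[of "2 ^ k * \<nu>"] frac_ge_0[of "2 ^ k * \<nu>"]
    by (auto simp: frac_double min_def)
qed

text \<open>The index \<open>s\<close> counts grid steps and is real, so that integer indices, their
  doubles and the exact position \<open>2 ^ k * \<nu>\<close> can be compared in one
  arithmetic.\<close>

definition dyadic_mean :: "real \<Rightarrow> real \<Rightarrow> nat \<Rightarrow> real \<Rightarrow> real" where
  "dyadic_mean a b k s = a powr (1 - s / 2 ^ k) * b powr (s / 2 ^ k)"

lemma dyadic_mean_Suc_even: "dyadic_mean a b (Suc k) (2 * s) = dyadic_mean a b k s"
  unfolding dyadic_mean_def by simp

text \<open>The points new to the finer grid are geometric midpoints of old neighbours. The squared
  form avoids a root and is the form in which the telescoping meets these points.\<close>

lemma dyadic_mean_Suc_odd: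
  assumes "a > 0" "b > 0"
  shows "(dyadic_mean a b (Suc k) (2 * s + 1))\<^sup>2 = dyadic_mean a b k s * dyadic_mean a b k (s + 1)"
proof -
  have "(dyadic_mean a b (Suc k) (2 * s + 1))\<^sup>2 =
     a powr (2 * (1 - (2 * s + 1) / 2 ^ Suc k)) * b powr (2 * ((2 * s + 1) / 2 ^ Suc k))"
    using assms by (simp add: dyadic_mean_def power_mult_distrib powr_square)
  also have "2 * (1 - (2 * s + 1) / 2 ^ Suc k) = (1 - s / 2 ^ k) + (1 - (s + 1) / 2 ^ k)"
    by (simp add: field_simps)
  also have "2 * ((2 * s + 1) / 2 ^ Suc k) = s / 2 ^ k + (s + 1) / 2 ^ k"
    by (simp add: field_simps)
  finally show ?thesis by (simp only: dyadic_mean_def powr_add ac_simps)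
qed

lemma dyadic_mean_pos: "a > 0 \<Longrightarrow> b > 0 \<Longrightarrow> dyadic_mean a b k s > 0"
  unfolding dyadic_mean_def by simp

text \<open>Induction on \<open>t\<close>. Subtracting \<open>r * (p - q)\<^sup>2\<close>, with
  \<open>r\<close> the smaller of the two weights, removes the square carrying that weight and
  creates the product \<open>p * q\<close>, which is the square of the midpoint.\<close>

lemma young_telescope:
  fixes a b \<nu> :: real
  assumes "a > 0" "b > 0" "0 < \<nu>" "\<nu> < 1"
  shows "(1 - \<nu>) * a\<^sup>2 + \<nu> * b\<^sup>2
      - (\<Sum>k<t. r_seq \<nu> k * (dyadic_mean a b k (m_seq \<nu> k) - dyadic_mean a b k (m_seq \<nu> k + 1))\<^sup>2)
    = (1 - frac (2 ^ t * \<nu>)) * (dyadic_mean a b t (m_seq \<nu> t))\<^sup>2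
      + frac (2 ^ t * \<nu>) * (dyadic_mean a b t (m_seq \<nu> t + 1))\<^sup>2"
proof (induction t)
  case 0
  have "frac \<nu> = \<nu>" using assms by (simp add: frac_eq)
  then show ?case using assms by (simp add: m_seq_frac dyadic_mean_def)
next
  case (Suc t)
  define w where "w = frac (2 ^ t * \<nu>)"
  define s where "s = real_of_int (m_seq \<nu> t)"
  define p where "p = dyadic_mean a b t s"
  define q where "q = dyadic_mean a b t (s + 1)"
  have d: "frac (2 ^ Suc t * \<nu>) = (if w < 1/2 then 2 * w else 2 * w - 1)"
    using frac_double[of "2 ^ t * \<nu>"] unfolding w_def by (simp add: mult.assoc)
  have s': "s = 2 ^ t * \<nu> - w" unfolding s_def w_def by (rule m_seq_frac)
  have m: "real_of_int (m_seq \<nu> (Suc t)) = (if w < 1/2 then 2 * s else 2 * s + 1)"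
    unfolding m_seq_frac d s' by simp
  have r: "r_seq \<nu> t = (if w < 1/2 then w else 1 - w)"
    using r_seq_frac[OF assms(3,4), of t] unfolding w_def by auto
  have ev: "dyadic_mean a b (Suc t) (2 * s) = p"
    "dyadic_mean a b (Suc t) (2 * s + 2) = q"
    using dyadic_mean_Suc_even[of a b t s] dyadic_mean_Suc_even[of a b t "s + 1"]
    unfolding p_def q_def by simp_all
  have od: "(dyadic_mean a b (Suc t) (2 * s + 1))\<^sup>2 = p * q"
    unfolding p_def q_def using assms by (intro dyadic_mean_Suc_odd)
  have "(1 - w) * p\<^sup>2 + w * q\<^sup>2 - r_seq \<nu> t * (p - q)\<^sup>2 =
     (1 - frac (2 ^ Suc t * \<nu>)) * (dyadic_mean a b (Suc t) (m_seq \<nu> (Suc t)))\<^sup>2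
      + frac (2 ^ Suc t * \<nu>) * (dyadic_mean a b (Suc t) (m_seq \<nu> (Suc t) + 1))\<^sup>2"
  \<comment> \<open>The next binary digit of \<nu> decides which half interval survives. For digit 0
    it runs from \<open>p\<close> to the midpoint, for digit 1 from the midpoint to
    \<open>q\<close>; weight and floor change accordingly.\<close>
  proof (cases "w < 1/2")
    case True
    then have *: "frac (2 ^ Suc t * \<nu>) = 2 * w" "real_of_int (m_seq \<nu> (Suc t)) = 2 * s"
      "real_of_int (m_seq \<nu> (Suc t) + 1) = 2 * s + 1" "r_seq \<nu> t = w" using d m r by auto
    show ?thesis unfolding * ev od by (simp add: algebra_simps power2_eq_square)
  next
    case False
    then have *: "frac (2 ^ Suc t * \<nu>) = 2 * w - 1" "real_of_int (m_seq \<nu> (Suc t)) = 2 * s + 1"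
      "real_of_int (m_seq \<nu> (Suc t) + 1) = 2 * s + 2" "r_seq \<nu> t = 1 - w" using d m r by auto
    show ?thesis unfolding * ev od by (simp add: algebra_simps power2_eq_square)
  qed
  then show ?case using Suc unfolding w_def[symmetric] s_def[symmetric]
    by (simp add: p_def q_def s_def)
qed

text \<open>The telescoped sum is a weighted arithmetic mean of two squared neighbours
  \<open>p\<close> and \<open>q\<close> on the grid of level \<open>t\<close>. It remains to
  identify \<open>q / p\<close> with the argument of the Kantorovich constant and the geometric mean
  of \<open>p\<close> and \<open>q\<close> with the required square.\<close>

lemma young_kantorovich_dyadic:
  fixes a b \<nu> :: real
  assumes "a > 0" "b > 0" "0 < \<nu>" "\<nu> < 1" "t \<ge> 1"
  defines "S \<equiv> ((1 - \<nu>) * a + \<nu> * b)\<^sup>2 - (r_seq \<nu> 0)\<^sup>2 * (a - b)\<^sup>2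
      - (\<Sum>k = 1..t - 1. r_seq \<nu> k *
          (dyadic_mean a b k (m_seq \<nu> k) - dyadic_mean a b k (m_seq \<nu> k + 1))\<^sup>2)"
    and "h \<equiv> kantorovich2 ((b / a) powr (1 / 2 ^ (t - 1)))"
  shows "h powr r_seq \<nu> t * (a powr (1 - \<nu>) * b powr \<nu>)\<^sup>2 \<le> S"
    and "S \<le> h powr R_seq \<nu> t * (a powr (1 - \<nu>) * b powr \<nu>)\<^sup>2"
proof -
  define w where "w = frac (2 ^ t * \<nu>)"
  define s where "s = real_of_int (m_seq \<nu> t)"
  define p where "p = (dyadic_mean a b t s)\<^sup>2"
  define q where "q = (dyadic_mean a b t (s + 1))\<^sup>2"
  have pq: "p > 0" "q > 0"
    unfolding p_def q_def using dyadic_mean_pos[OF assms(1,2)] by (intro zero_less_power; blast)+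
  have s': "s + w = 2 ^ t * \<nu>" unfolding s_def w_def m_seq_frac by simp
  \<comment> \<open>The term for \<open>k = 0\<close> is split off: its grid points are
    \<open>a\<close> and \<open>b\<close> themselves, and it has coefficient
    \<open>r_seq \<nu> 0\<close> where \<open>S\<close> has the square of that number.\<close>
  have "{..<t} = insert 0 {1..t - 1}" using assms(5) by auto
  moreover have "\<lfloor>\<nu>\<rfloor> = 0" using assms(3,4) by linarith
  ultimately have "(\<Sum>k<t. r_seq \<nu> k * (dyadic_mean a b k (m_seq \<nu> k) - dyadic_mean a b k (m_seq \<nu> k + 1))\<^sup>2)
    = r_seq \<nu> 0 * (a - b)\<^sup>2 + (\<Sum>k = 1..t - 1. r_seq \<nu> k *
          (dyadic_mean a b k (m_seq \<nu> k) - dyadic_mean a b k (m_seq \<nu> k + 1))\<^sup>2)"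
    using assms(1,2) \<open>\<lfloor>\<nu>\<rfloor> = 0\<close> by (simp add: m_seq_def dyadic_mean_def)
  \<comment> \<open>The square of the mean falls short of the mean of the squares by
    \<open>\<nu> * (1 - \<nu>) * (a - b)\<^sup>2\<close>, and this deficit plus the squared
    coefficient adds up to \<open>r_seq \<nu> 0\<close>.\<close>
  moreover have "((1 - \<nu>) * a + \<nu> * b)\<^sup>2 - (r_seq \<nu> 0)\<^sup>2 * (a - b)\<^sup>2
      = (1 - \<nu>) * a\<^sup>2 + \<nu> * b\<^sup>2 - r_seq \<nu> 0 * (a - b)\<^sup>2"
    by (simp add: min_def power2_eq_square algebra_simps)
  ultimately have S: "S = (1 - w) * p + w * q"
    using young_telescope[of a b \<nu> t] assms(1-4) unfolding S_def w_def p_def q_def s_def by simp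
  have p': "p = a powr (2 * (1 - s / 2 ^ t)) * b powr (2 * (s / 2 ^ t))"
    using assms(1,2) by (simp add: p_def dyadic_mean_def power_mult_distrib powr_square)
  have q': "q = a powr (2 * (1 - (s + 1) / 2 ^ t)) * b powr (2 * ((s + 1) / 2 ^ t))"
    using assms(1,2) by (simp add: q_def dyadic_mean_def power_mult_distrib powr_square)
  obtain t' where t': "t = Suc t'" using assms(5) by (cases t) auto
  \<comment> \<open>Neighbours at level \<open>t\<close> differ by \<open>1 / 2 ^ t\<close> in the
    exponent; squaring doubles this, hence the exponent \<open>t - 1\<close>.\<close>
  have "ln q - ln p = ln (b / a) / 2 ^ (t - 1)"
    using assms(1,2) unfolding p' q' t'
    by (simp add: ln_mult ln_powr ln_div field_simps)
  then have "ln (q / p) = ln ((b / a) powr (1 / 2 ^ (t - 1)))"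
    using assms(1,2) pq by (simp add: ln_div)
  then have "q / p = (b / a) powr (1 / 2 ^ (t - 1))"
    using assms(1,2) pq by (subst (asm) ln_inj_iff) auto
  then have h: "h = kantorovich2 (q / p)" unfolding h_def by simp
  \<comment> \<open>On a logarithmic scale this mean sits at grid position \<open>s + w\<close>,
    which is \<open>2 ^ t * \<nu>\<close> exactly.\<close>
  have "ln (p powr (1 - w) * q powr w) = (1 - w) * ln p + w * ln q"
    using pq by (simp add: ln_mult ln_powr)
  also have "\<dots> = 2 * (1 - (s + w) / 2 ^ t) * ln a + 2 * ((s + w) / 2 ^ t) * ln b"
    using assms(1,2) unfolding p' q' by (simp add: ln_mult ln_powr field_simps)
  also have "\<dots> = ln ((a powr (1 - \<nu>) * b powr \<nu>)\<^sup>2)"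
    using assms(1,2) unfolding s' by (simp add: ln_mult ln_powr ln_realpow algebra_simps)
  finally have g: "p powr (1 - w) * q powr w = (a powr (1 - \<nu>) * b powr \<nu>)\<^sup>2"
    using assms(1,2) pq by (subst (asm) ln_inj_iff) auto
  have w: "0 \<le> w" "w \<le> 1" unfolding w_def by (simp_all add: frac_lt_1 less_imp_le)
  show "h powr r_seq \<nu> t * (a powr (1 - \<nu>) * b powr \<nu>)\<^sup>2 \<le> S"
    and "S \<le> h powr R_seq \<nu> t * (a powr (1 - \<nu>) * b powr \<nu>)\<^sup>2"
    using young_kantorovich[OF pq w] r_seq_frac[OF assms(3,4), of t]
    unfolding S h g R_seq_def w_def[symmetric] by simp_all
qed

section \<open>Unitary invariance of the Hilbert-Schmidt norm\<close>

lemma mat_adjoint_dim [simp]: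
  "dim_row (mat_adjoint A) = dim_col A" "dim_col (mat_adjoint A) = dim_row A"
  unfolding mat_adjoint_def by auto

lemma mat_adjoint_index [simp]:
  "i < dim_col A \<Longrightarrow> j < dim_row A \<Longrightarrow> mat_adjoint A $$ (i, j) = conjugate (A $$ (j, i))"
  unfolding mat_adjoint_def by (simp add: mat_of_rows_index)

lemma mat_adjoint_adjoint [simp]: "mat_adjoint (mat_adjoint A) = A"
  by (rule eq_matI) auto

lemma mat_adjoint_mult:
  fixes A B :: "complex mat"
  assumes "A \<in> carrier_mat n m" "B \<in> carrier_mat m k"
  shows "mat_adjoint (A * B) = mat_adjoint B * mat_adjoint A"
  by (rule eq_matI) (use assms in \<open>auto simp: scalar_prod_def mult.commute\<close>)

lemma mat_adjoint_mult_index: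
  fixes A B :: "complex mat"
  assumes "i < dim_col A" "j < dim_col B" "dim_row A = dim_row B"
  shows "(mat_adjoint A * B) $$ (i, j) = (\<Sum>k<dim_row B. cnj (A $$ (k, i)) * B $$ (k, j))"
  using assms by (simp add: scalar_prod_def lessThan_atLeast0)

lemma hilbert_schmidt_norm_square:
  "(hilbert_schmidt_norm A)\<^sup>2 = (\<Sum>i<dim_row A. \<Sum>j<dim_col A. (cmod (A $$ (i,j)))\<^sup>2)"
  unfolding hilbert_schmidt_norm_def by (simp add: sum_nonneg)

lemma hilbert_schmidt_norm_adjoint: "hilbert_schmidt_norm (mat_adjoint A) = hilbert_schmidt_norm A"
  unfolding hilbert_schmidt_norm_def by (simp, subst sum.swap, simp)

text \<open>The trace form of the norm: unitary invariance becomes cancellation of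
  \<open>mat_adjoint U * U\<close> inside a product.\<close>

lemma hilbert_schmidt_norm_square_adjoint_mult:
  "complex_of_real ((hilbert_schmidt_norm A)\<^sup>2) = (\<Sum>j<dim_col A. (mat_adjoint A * A) $$ (j, j))"
proof -
  have "complex_of_real ((hilbert_schmidt_norm A)\<^sup>2)
    = (\<Sum>i<dim_row A. \<Sum>j<dim_col A. cnj (A $$ (i,j)) * A $$ (i,j))"
    by (simp only: hilbert_schmidt_norm_square of_real_sum complex_norm_square mult.commute)
  also have "\<dots> = (\<Sum>j<dim_col A. (mat_adjoint A * A) $$ (j, j))"
    by (subst sum.swap) (simp add: mat_adjoint_mult_index del: index_mult_mat)
  finally show ?thesis .
qed

lemma hilbert_schmidt_norm_unitary_left:
  assumes U: "U \<in> carrier_mat n n" "mat_adjoint U * U = 1\<^sub>m n" and M: "M \<in> carrier_mat n m"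
  shows "hilbert_schmidt_norm (U * M) = hilbert_schmidt_norm M"
proof -
  note U' = mat_adjoint_carrier[OF U(1)] and M' = mat_adjoint_carrier[OF M]
  have "mat_adjoint (U * M) * (U * M) = mat_adjoint M * (mat_adjoint U * U) * M"
    using U(1) M U' M' by (simp add: mat_adjoint_mult[OF U(1) M] assoc_mult_mat[of _ _ n _ n _ m]
      assoc_mult_mat[of _ m n _ n _ n])
  then have "mat_adjoint (U * M) * (U * M) = mat_adjoint M * M"
    unfolding U(2) right_mult_one_mat[OF M'] .
  then have "complex_of_real ((hilbert_schmidt_norm (U * M))\<^sup>2)
      = complex_of_real ((hilbert_schmidt_norm M)\<^sup>2)"
    unfolding hilbert_schmidt_norm_square_adjoint_mult using U M by simp
  then have "(hilbert_schmidt_norm (U * M))\<^sup>2 = (hilbert_schmidt_norm M)\<^sup>2"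
    unfolding of_real_eq_iff .
  then show ?thesis
    by (rule power2_eq_imp_eq) (auto simp: hilbert_schmidt_norm_def intro!: sum_nonneg)
qed

text \<open>Taking adjoints preserves the norm and moves the unitary factor to the left.\<close>

lemma hilbert_schmidt_norm_unitary_right:
  assumes V: "V \<in> carrier_mat n n" "mat_adjoint V * V = 1\<^sub>m n" and M: "M \<in> carrier_mat m n"
  shows "hilbert_schmidt_norm (M * mat_adjoint V) = hilbert_schmidt_norm M"
proof -
  note V' = mat_adjoint_carrier[OF V(1)] and M' = mat_adjoint_carrier[OF M]
  have "hilbert_schmidt_norm (M * mat_adjoint V) = hilbert_schmidt_norm (V * mat_adjoint M)"
    using mat_adjoint_mult[OF M V'] hilbert_schmidt_norm_adjoint[of "M * mat_adjoint V"] by simp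
  then show ?thesis
    using hilbert_schmidt_norm_unitary_left[OF V M'] hilbert_schmidt_norm_adjoint[of M] by simp
qed

section \<open>Spectral decomposition of Hermitian matrices\<close>

lemma unitary_completion:
  fixes v :: "complex vec"
  assumes v: "v \<in> carrier_vec n" "v \<noteq> 0\<^sub>v n"
  obtains W c where "W \<in> carrier_mat n n" "mat_adjoint W * W = 1\<^sub>m n" "col W 0 = c \<cdot>\<^sub>v v"
proof -
  interpret cof_vec_space n "TYPE(complex)" .
  define b where "b = basis_completion v"
  \<comment> \<open>\<open>gram_schmidt\<close> orthogonalises without normalising and keeps the
    first vector. So \<open>v\<close> survives as \<open>ws ! 0\<close>, and the lengths are
    corrected below by the factors \<open>c\<close>.\<close>
  define ws where "ws = gram_schmidt n b"
  note bc = basis_completion[OF v, folded b_def]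
  have n: "n \<noteq> 0" using v by auto
  then obtain vs where bv: "b = v # vs" using bc(6,7) by (cases b) auto
  note gs = gram_schmidt_result[OF bc(2,4,5) ws_def]
  have len: "length ws = n" using gs(4) bc(6) by simp
  have hd: "ws ! 0 = v"
    using gram_schmidt_hd[OF v(1), of vs] len n
    unfolding ws_def bv by (metis hd_conv_nth length_0_conv)
  have wsc [simp]: "ws ! i \<in> carrier_vec n" "dim_vec (ws ! i) = n" if "i < n" for i
    using gs(3) len that nth_mem[of i ws] by fastforce+
  define N where "N = (\<lambda>i. \<Sum>k<n. (cmod (ws ! i $ k))\<^sup>2)"
  have ip: "ws ! j \<bullet>c ws ! i = (\<Sum>k<n. cnj (ws ! i $ k) * ws ! j $ k)" if "i < n" "j < n" for i j
    using that by (simp add: scalar_prod_def lessThan_atLeast0 mult.commute)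
  have ip_self: "ws ! i \<bullet>c ws ! i = complex_of_real (N i)" if "i < n" for i
    using ip[OF that that] by (simp only: N_def of_real_sum complex_norm_square mult.commute)
  have N: "N i > 0" if "i < n" for i
  proof -
    have "N i \<noteq> 0" using corthogonalD[OF gs(2), of i i] ip_self[OF that] len that by auto
    moreover have "N i \<ge> 0" unfolding N_def by (intro sum_nonneg) auto
    ultimately show ?thesis by simp
  qed
  define c where "c = (\<lambda>i. complex_of_real (1 / sqrt (N i)))"
  define W where "W = mat n n (\<lambda>(k, i). c i * ws ! i $ k)"
  have W: "W \<in> carrier_mat n n" unfolding W_def by simp
  have "(mat_adjoint W * W) $$ (i, j) = 1\<^sub>m n $$ (i, j)" if ij: "i < n" "j < n" for i j
  proof -
    have "(mat_adjoint W * W) $$ (i, j) = c i * c j * (ws ! j \<bullet>c ws ! i)"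
      using ij unfolding ip[OF ij] W_def
      by (subst mat_adjoint_mult_index) (auto simp: c_def sum_distrib_left ac_simps intro!: sum.cong)
    also have "\<dots> = 1\<^sub>m n $$ (i, j)"
    proof (cases "i = j")
      case True
      have "c i * c i * complex_of_real (N i) = complex_of_real (1 / sqrt (N i) * (1 / sqrt (N i)) * N i)"
        unfolding c_def of_real_mult ..
      also have "1 / sqrt (N i) * (1 / sqrt (N i)) * N i = 1"
        using N[OF ij(1)] by simp
      finally show ?thesis using True ij ip_self by simp
    next
      case False
      then have "ws ! j \<bullet>c ws ! i = 0" using corthogonalD[OF gs(2), of j i] ij len by auto
      then show ?thesis using False ij by simp
    qed
    finally show ?thesis .
  qed
  then have "mat_adjoint W * W = 1\<^sub>m n" using W by (intro eq_matI) auto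
  moreover have "col W 0 = c 0 \<cdot>\<^sub>v v"
    using n v hd by (intro eq_vecI) (auto simp: W_def)
  ultimately show ?thesis using W that by blast
qed

text \<open>Deflation by induction on the list of roots: split off one eigenvector and recurse on
  its orthogonal complement. The list is prescribed so that the diagonal follows the given order of
  the eigenvalues.\<close>

lemma hermitian_unitary_diagonalization:
  fixes A :: "complex mat"
  assumes "A \<in> carrier_mat n n" "mat_adjoint A = A" "char_poly A = (\<Prod>e\<leftarrow>es. [:- e, 1:])"
  shows "\<exists>U \<in> carrier_mat n n. mat_adjoint U * U = 1\<^sub>m n \<and> A * U = U * mat_diag n (\<lambda>i. es ! i)"
  using assms
proof (induction es arbitrary: n A)
  case Nil
  then have "n = 0" using degree_monic_char_poly[of A n] by simp
  then show ?case using Nil(1) by (intro bexI[of _ "1\<^sub>m 0"]) (auto simp: mat_diag_def)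
next
  case (Cons e es)
  note A = Cons.prems(1)
  define m where "m = n - 1"
  have "n = length (e # es)"
    using degree_monic_char_poly[OF A] degree_linear_factors[of uminus "e # es"]
    unfolding Cons.prems(3) by simp
  then have n: "n = Suc m" unfolding m_def by simp
  have "eigenvalue A e"
    unfolding eigenvalue_root_char_poly[OF A] Cons.prems(3) by simp
  then obtain v where "eigenvector A v e" unfolding eigenvalue_def by auto
  then have v: "v \<in> carrier_vec n" "v \<noteq> 0\<^sub>v n" "A *\<^sub>v v = e \<cdot>\<^sub>v v"
    using A unfolding eigenvector_def by auto
  obtain W c where W: "W \<in> carrier_mat n n" "mat_adjoint W * W = 1\<^sub>m n" and W0: "col W 0 = c \<cdot>\<^sub>v v"
    using unitary_completion[OF v(1,2)] by blast
  note W' = mat_adjoint_carrier[OF W(1)]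
  have WW': "W * mat_adjoint W = 1\<^sub>m n" by (rule mat_mult_left_right_inverse[OF W' W])
  \<comment> \<open>In the new basis the first column is \<open>e\<close> followed by zeros, since
    column 0 of \<open>W\<close> is an eigenvector. Hermitian symmetry clears the first row too, so
    \<open>H\<close> is block diagonal.\<close>
  define H where "H = mat_adjoint W * (A * W)"
  have H: "H \<in> carrier_mat n n" using A W W' unfolding H_def by simp
  note AW = mult_carrier_mat[OF A W(1)]
  have WH: "W * H = A * W"
    using assoc_mult_mat[OF W(1) W' AW] unfolding H_def WW' left_mult_one_mat[OF AW] by simp
  have Hadj: "mat_adjoint H = H"
    unfolding H_def mat_adjoint_mult[OF W' AW] mat_adjoint_mult[OF A W(1)] mat_adjoint_adjoint
      Cons.prems(2) by (rule assoc_mult_mat[OF W' A W(1)])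
  have "col (A * W) 0 = A *\<^sub>v (c \<cdot>\<^sub>v v)"
    using col_mult2[OF A W(1), of 0] n W0 by simp
  then have AW0: "col (A * W) 0 = e \<cdot>\<^sub>v col W 0"
    unfolding mult_mat_vec[OF A v(1)] v(3) W0 smult_smult_assoc by (simp only: mult.commute)
  have H0: "H $$ (i, 0) = (if i = 0 then e else 0)" if i: "i < n" for i
  proof -
    have "H $$ (i, 0) = row (mat_adjoint W) i \<bullet> col (A * W) 0"
      using i n A W W' unfolding H_def by simp
    also have "\<dots> = e * (row (mat_adjoint W) i \<bullet> col W 0)"
      unfolding AW0 using i W W' by simp
    also have "row (mat_adjoint W) i \<bullet> col W 0 = (mat_adjoint W * W) $$ (i, 0)"
      using i n W(1) W' by simp
    finally show ?thesis unfolding W(2) using i n by simp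
  qed
  have H0': "H $$ (0, j) = 0" if "0 < j" "j < n" for j
  proof -
    have "H $$ (0, j) = mat_adjoint H $$ (0, j)" unfolding Hadj ..
    also have "\<dots> = 0" using that H H0[of j] by simp
    finally show ?thesis .
  qed
  define H3 where "H3 = mat m m (\<lambda>(i, j). H $$ (Suc i, Suc j))"
  have H3: "H3 \<in> carrier_mat m m" unfolding H3_def by simp
  let ?E = "mat 1 1 (\<lambda>_. e)"
  have Hb: "H = four_block_mat ?E (0\<^sub>m 1 m) (0\<^sub>m m 1) H3"
    using H n by (intro eq_matI) (auto simp: H0 H0' H3_def)
  have H3adj: "mat_adjoint H3 = H3"
  proof (rule eq_matI)
    fix i j assume ij: "i < dim_row H3" "j < dim_col H3"
    then have "H $$ (Suc i, Suc j) = conjugate (H $$ (Suc j, Suc i))"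
      using H n mat_adjoint_index[of "Suc i" H "Suc j"] unfolding Hadj H3_def by simp
    then show "mat_adjoint H3 $$ (i, j) = H3 $$ (i, j)" using ij by (simp add: H3_def)
  qed (simp_all add: H3_def)
  \<comment> \<open>Similarity preserves the characteristic polynomial; cancelling the factor of
    \<open>e\<close> leaves exactly the roots \<open>es\<close> for the block
    \<open>H3\<close>.\<close>
  have "H = mat_adjoint W * A * W"
    unfolding H_def by (rule assoc_mult_mat[OF W' A W(1), symmetric])
  then have "similar_mat_wit H A (mat_adjoint W) W"
    by (rule similar_mat_witI[OF W(2) WW' _ H A W' W(1)])
  then have "similar_mat H A" unfolding similar_mat_def by blast
  then have "char_poly H = [:- e, 1:] * (\<Prod>e\<leftarrow>es. [:- e, 1:])"
    using char_poly_similar Cons.prems(3) by fastforce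
  moreover have "char_poly H = char_poly ?E * char_poly H3"
    unfolding Hb by (rule char_poly_four_block_zeros_col[OF _ _ H3]) auto
  moreover have "char_poly ?E = [:- e, 1:]"
    by (simp add: char_poly_defs det_def sign_def)
  ultimately have cp: "char_poly H3 = (\<Prod>e\<leftarrow>es. [:- e, 1:])"
    by (metis mult_cancel_left pCons_eq_0_iff zero_neq_one)
  obtain P where P: "P \<in> carrier_mat m m" "mat_adjoint P * P = 1\<^sub>m m"
    and HP: "H3 * P = P * mat_diag m (\<lambda>i. es ! i)"
    using Cons.IH[OF H3 H3adj cp] by blast
  define Q where "Q = four_block_mat (1\<^sub>m 1) (0\<^sub>m 1 m) (0\<^sub>m m 1) P"
  have Q: "Q \<in> carrier_mat n n" using P unfolding Q_def n by (intro carrier_matI) simp_all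
  have Qadj: "mat_adjoint Q = four_block_mat (1\<^sub>m 1) (0\<^sub>m 1 m) (0\<^sub>m m 1) (mat_adjoint P)"
    using P(1) unfolding Q_def by (intro eq_matI) auto
  have QQ: "mat_adjoint Q * Q = 1\<^sub>m n"
  proof -
    have "mat_adjoint Q * Q = four_block_mat (1\<^sub>m 1) (0\<^sub>m 1 m) (0\<^sub>m m 1) (1\<^sub>m m)"
      unfolding Qadj unfolding Q_def
      using P mat_adjoint_carrier[OF P(1)]
      by (subst mult_four_block_mat[where ?nr1.0 = 1 and ?n1.0 = 1 and ?n2.0 = m
        and ?nr2.0 = m and ?nc1.0 = 1 and ?nc2.0 = m]) auto
    also have "\<dots> = 1\<^sub>m n" unfolding n by (intro eq_matI) auto
    finally show ?thesis .
  qed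
  define D where "D = mat_diag n (\<lambda>i. (e # es) ! i)"
  have D: "D \<in> carrier_mat n n" unfolding D_def by simp
  have Db: "D = four_block_mat ?E (0\<^sub>m 1 m) (0\<^sub>m m 1) (mat_diag m (\<lambda>i. es ! i))"
    unfolding D_def n by (intro eq_matI) (auto simp: mat_diag_def nth_Cons')
  have HQ: "H * Q = Q * D"
  proof -
    have "H * Q = four_block_mat ?E (0\<^sub>m 1 m) (0\<^sub>m m 1) (H3 * P)"
      unfolding Hb Q_def using P H3
      by (subst mult_four_block_mat[where ?nr1.0 = 1 and ?n1.0 = 1 and ?n2.0 = m
        and ?nr2.0 = m and ?nc1.0 = 1 and ?nc2.0 = m]) auto
    moreover have "Q * D = four_block_mat ?E (0\<^sub>m 1 m) (0\<^sub>m m 1) (P * mat_diag m (\<lambda>i. es ! i))"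
      unfolding Db Q_def using P
      by (subst mult_four_block_mat[where ?nr1.0 = 1 and ?n1.0 = 1 and ?n2.0 = m
        and ?nr2.0 = m and ?nc1.0 = 1 and ?nc2.0 = m]) (auto simp: left_mult_zero_mat[OF mat_diag_dim])
    ultimately show ?thesis using HP by simp
  qed
  have "mat_adjoint (W * Q) * (W * Q) = mat_adjoint Q * ((mat_adjoint W * W) * Q)"
    using W(1) W' Q mat_adjoint_carrier[OF Q]
    by (simp add: mat_adjoint_mult[of _ n n _ n] assoc_mult_mat[of _ n n _ n _ n])
  then have 1: "mat_adjoint (W * Q) * (W * Q) = 1\<^sub>m n"
    unfolding W(2) left_mult_one_mat[OF Q] QQ .
  have "A * (W * Q) = (W * H) * Q"
    unfolding WH by (rule assoc_mult_mat[OF A W(1) Q, symmetric])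
  also have "\<dots> = W * (Q * D)"
    unfolding assoc_mult_mat[OF W(1) H Q] HQ ..
  also have "\<dots> = (W * Q) * D"
    by (rule assoc_mult_mat[OF W(1) Q D, symmetric])
  finally show ?case using 1 W(1) Q unfolding D_def by (intro bexI[of _ "W * Q"]) auto
qed

lemma positive_definite_spectral_decomp:
  assumes A: "A \<in> carrier_mat n n" "positive_definite A" and ev: "eigenvalues_with_mult n A lam"
  obtains U where "U \<in> carrier_mat n n" "positive_spectral_decomp A U lam"
proof -
  define es where "es = map (\<lambda>i. complex_of_real (lam i)) [0..<n]"
  have "char_poly A = (\<Prod>e\<leftarrow>es. [:- e, 1:])"
    using ev unfolding eigenvalues_with_mult_def es_def
    by (simp add: prod.list_conv_set_nth lessThan_atLeast0)
  then obtain U where U: "U \<in> carrier_mat n n" "mat_adjoint U * U = 1\<^sub>m n"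
    and AU: "A * U = U * mat_diag n (\<lambda>i. es ! i)"
    using hermitian_unitary_diagonalization[OF A(1)] A(2) unfolding positive_definite_def by blast
  note U' = mat_adjoint_carrier[OF U(1)]
  have D: "mat_diag n (\<lambda>i. es ! i) = real_diag n lam"
    unfolding real_diag_def es_def by (intro eq_matI) (auto simp: mat_diag_def)
  have UU': "U * mat_adjoint U = 1\<^sub>m n" by (rule mat_mult_left_right_inverse[OF U' U])
  have "A = A * (U * mat_adjoint U)" using A(1) unfolding UU' by simp
  also have "\<dots> = U * real_diag n lam * mat_adjoint U"
    using assoc_mult_mat[OF A(1) U(1) U'] unfolding AU D by simp
  finally have dec: "A = U * real_diag n lam * mat_adjoint U" .
  \<comment> \<open>The quadratic form of \<open>A\<close> at the unit eigenvector
    \<open>col U i\<close> has the value \<open>lam i\<close>.\<close>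
  have "lam i > 0" if i: "i < n" for i
  proof -
    let ?v = "col U i"
    have v: "?v \<in> carrier_vec n" using U(1) by (auto intro: carrier_vecI)
    have "?v \<bullet>c ?v = (mat_adjoint U * U) $$ (i, i)"
      using i U(1) by (simp add: scalar_prod_def mult.commute)
    then have vv: "?v \<bullet>c ?v = 1" unfolding U(2) using i by simp
    then have "?v \<noteq> 0\<^sub>v n" by auto
    then have pos: "Re ((A *\<^sub>v ?v) \<bullet>c ?v) > 0"
      using A v unfolding positive_definite_def by auto
    have "A *\<^sub>v ?v = col (A * U) i" using col_mult2[OF A(1) U(1) i] by simp
    also have "\<dots> = complex_of_real (lam i) \<cdot>\<^sub>v ?v"
      unfolding AU mat_diag_mult_right[OF U(1)] using i U(1)
      by (intro eq_vecI) (auto simp: es_def)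
    finally have "(A *\<^sub>v ?v) \<bullet>c ?v = complex_of_real (lam i) * (?v \<bullet>c ?v)"
      using v by simp
    then show ?thesis using pos unfolding vv by simp
  qed
  then show ?thesis
    using that U A(1) dec unfolding positive_spectral_decomp_def unitary_mat_def by auto
qed

section \<open>Schur multipliers in spectral coordinates\<close>

text \<open>A finite-dimensional double operator integral. With \<open>U\<close>, \<open>V\<close>
  and \<open>X\<close> fixed, every matrix whose norm occurs in the theorem is a value of this map,
  so matrix computations reduce to computations with the symbol \<open>f\<close>.\<close>

definition spectral_multiplier ::
  "complex mat \<Rightarrow> complex mat \<Rightarrow> complex mat \<Rightarrow> (nat \<Rightarrow> nat \<Rightarrow> real) \<Rightarrow> complex mat" where
  "spectral_multiplier U V X f =
     U * mat (dim_row X) (dim_col X)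
       (\<lambda>(i, j). complex_of_real (f i j) * (mat_adjoint U * X * V) $$ (i, j)) * mat_adjoint V"

lemma spectral_multiplier_norm:
  assumes "U \<in> carrier_mat n n" "unitary_mat U" "V \<in> carrier_mat m m" "unitary_mat V"
    and "X \<in> carrier_mat n m"
  shows "(hilbert_schmidt_norm (spectral_multiplier U V X f))\<^sup>2 =
    (\<Sum>i<n. \<Sum>j<m. (f i j)\<^sup>2 * (cmod ((mat_adjoint U * X * V) $$ (i, j)))\<^sup>2)"
proof -
  define M where "M = mat n m (\<lambda>(i, j). complex_of_real (f i j) * (mat_adjoint U * X * V) $$ (i, j))"
  have M: "M \<in> carrier_mat n m" unfolding M_def by simp
  have "spectral_multiplier U V X f = U * M * mat_adjoint V"
    using assms(5) unfolding spectral_multiplier_def M_def by simp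
  then have "hilbert_schmidt_norm (spectral_multiplier U V X f) = hilbert_schmidt_norm (U * M)"
    using hilbert_schmidt_norm_unitary_right[OF assms(3) unitary_mat_right(1)[OF assms(3,4)]
        mult_carrier_mat[OF assms(1) M]] by simp
  also have "\<dots> = hilbert_schmidt_norm M"
    by (rule hilbert_schmidt_norm_unitary_left[OF assms(1) unitary_mat_right(1)[OF assms(1,2)] M])
  finally have "hilbert_schmidt_norm (spectral_multiplier U V X f) = hilbert_schmidt_norm M" .
  then show ?thesis
    by (simp add: hilbert_schmidt_norm_square M_def norm_mult power_mult_distrib del: index_mult_mat)
qed

lemma spectral_multiplier_linear:
  assumes "U \<in> carrier_mat n n" "V \<in> carrier_mat m m" "X \<in> carrier_mat n m"
  shows "complex_of_real a \<cdot>\<^sub>m spectral_multiplier U V X f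
       + complex_of_real b \<cdot>\<^sub>m spectral_multiplier U V X g
     = spectral_multiplier U V X (\<lambda>i j. a * f i j + b * g i j)"
proof -
  define M where "M = (\<lambda>f. mat n m (\<lambda>(i, j). complex_of_real (f i j) * (mat_adjoint U * X * V) $$ (i, j)))"
  have M: "M f \<in> carrier_mat n m" for f unfolding M_def by simp
  note V' = mat_adjoint_carrier[OF assms(2)]
  have T: "spectral_multiplier U V X f = U * M f * mat_adjoint V" for f
    using assms(3) unfolding spectral_multiplier_def M_def by simp
  have "M (\<lambda>i j. a * f i j + b * g i j) = complex_of_real a \<cdot>\<^sub>m M f + complex_of_real b \<cdot>\<^sub>m M g"
    unfolding M_def by (intro eq_matI) (simp_all add: distrib_right del: index_mult_mat)
  then have "spectral_multiplier U V X (\<lambda>i j. a * f i j + b * g i j)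
    = (U * (complex_of_real a \<cdot>\<^sub>m M f) + U * (complex_of_real b \<cdot>\<^sub>m M g)) * mat_adjoint V"
    unfolding T
    by (simp only: mult_add_distrib_mat[OF assms(1) smult_carrier_mat[OF M] smult_carrier_mat[OF M]])
  also have "\<dots> = U * (complex_of_real a \<cdot>\<^sub>m M f) * mat_adjoint V
      + U * (complex_of_real b \<cdot>\<^sub>m M g) * mat_adjoint V"
    by (rule add_mult_distrib_mat[OF mult_carrier_mat[OF assms(1) smult_carrier_mat[OF M]]
          mult_carrier_mat[OF assms(1) smult_carrier_mat[OF M]] V'])
  also have "\<dots> = complex_of_real a \<cdot>\<^sub>m (U * M f * mat_adjoint V)
      + complex_of_real b \<cdot>\<^sub>m (U * M g * mat_adjoint V)"
    by (simp only: mult_smult_distrib[OF assms(1) M]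
      mult_smult_assoc_mat[OF mult_carrier_mat[OF assms(1) M] V'])
  finally show ?thesis unfolding T ..
qed

lemma spectral_multiplier_diff:
  assumes "U \<in> carrier_mat n n" "V \<in> carrier_mat m m" "X \<in> carrier_mat n m"
  shows "spectral_multiplier U V X f - spectral_multiplier U V X g
     = spectral_multiplier U V X (\<lambda>i j. f i j - g i j)"
proof -
  have T: "spectral_multiplier U V X f \<in> carrier_mat n m" for f
    using assms(3) unfolding spectral_multiplier_def
    by (intro mult_carrier_mat[OF mult_carrier_mat[OF assms(1)] mat_adjoint_carrier[OF assms(2)]]) simp
  have "spectral_multiplier U V X f - spectral_multiplier U V X g
    = complex_of_real 1 \<cdot>\<^sub>m spectral_multiplier U V X f
       + complex_of_real (- 1) \<cdot>\<^sub>m spectral_multiplier U V X g"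
    using T[of f] T[of g] by (intro eq_matI) auto
  then show ?thesis unfolding spectral_multiplier_linear[OF assms] by simp
qed

section \<open>Real powers of positive definite matrices as multipliers\<close>

lemma positive_spectral_decompD:
  assumes "positive_spectral_decomp A U d" "A \<in> carrier_mat n n"
  shows "U \<in> carrier_mat n n" "unitary_mat U" "\<And>i. i < n \<Longrightarrow> d i > 0"
    and "A = U * real_diag n d * mat_adjoint U"
proof -
  have n: "dim_row A = n" using assms(2) by simp
  show "U \<in> carrier_mat n n" "unitary_mat U" "\<And>i. i < n \<Longrightarrow> d i > 0"
    and "A = U * real_diag n d * mat_adjoint U"
    using assms(1) unfolding positive_spectral_decomp_def n by blast+
qed

text \<open>In the coordinates \<open>mat_adjoint U * X * V\<close>, the left power scales rows and
  the right power scales columns, so the symbol is a product.\<close>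

lemma mat_powr_mult_mat_powr:
  assumes "A \<in> carrier_mat n n" "B \<in> carrier_mat m m" "X \<in> carrier_mat n m"
    and "positive_spectral_decomp A U d" "positive_spectral_decomp B V e"
  shows "mat_powr A s * X * mat_powr B u = spectral_multiplier U V X (\<lambda>i j. d i powr s * e j powr u)"
proof -
  let ?D = "real_diag n (\<lambda>i. d i powr s)" and ?E = "real_diag m (\<lambda>j. e j powr u)"
  note U = positive_spectral_decompD(1)[OF assms(4,1)] and V = positive_spectral_decompD(1)[OF assms(5,2)]
  note U' = mat_adjoint_carrier[OF U] and V' = mat_adjoint_carrier[OF V]
  have Y: "mat_adjoint U * X * V \<in> carrier_mat n m" using U' V assms(3) by simp
  have D: "?D \<in> carrier_mat n n" and E: "?E \<in> carrier_mat m m" by simp_all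
  note UD = mult_carrier_mat[OF U D] and VE = mult_carrier_mat[OF V E]
    and U'X = mult_carrier_mat[OF U' assms(3)] and DY = mult_carrier_mat[OF D Y]
  have "mat_powr A s * X * mat_powr B u = (U * ?D * mat_adjoint U) * X * (V * ?E * mat_adjoint V)"
    using assms(1,2) by (simp add: mat_powr_eq[OF assms(4)] mat_powr_eq[OF assms(5)])
  also have "\<dots> = U * ?D * (mat_adjoint U * X) * (V * ?E) * mat_adjoint V"
    unfolding assoc_mult_mat[OF UD U' assms(3)]
    by (rule assoc_mult_mat[OF mult_carrier_mat[OF UD U'X] VE V', symmetric])
  also have "U * ?D * (mat_adjoint U * X) * (V * ?E) = U * ?D * (mat_adjoint U * X) * V * ?E"
    by (rule assoc_mult_mat[OF mult_carrier_mat[OF UD U'X] V E, symmetric])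
  also have "U * ?D * (mat_adjoint U * X) * V = U * (?D * (mat_adjoint U * X * V))"
    unfolding assoc_mult_mat[OF UD U'X V] by (rule assoc_mult_mat[OF U D Y])
  also have "U * (?D * (mat_adjoint U * X * V)) * ?E = U * (?D * (mat_adjoint U * X * V) * ?E)"
    by (rule assoc_mult_mat[OF U DY E])
  also have "?D * (mat_adjoint U * X * V) * ?E = mat n m (\<lambda>(i, j).
      complex_of_real (d i powr s * e j powr u) * (mat_adjoint U * X * V) $$ (i, j))"
    unfolding real_diag_def mat_diag_mult_left[OF Y]
    by (subst mat_diag_mult_right[of _ n m]) auto
  finally show ?thesis using assms(3) unfolding spectral_multiplier_def by simp
qed

lemma mat_powr_one:
  assumes "positive_spectral_decomp A U d" "A \<in> carrier_mat n n"
  shows "mat_powr A 1 = A"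
proof -
  note D = positive_spectral_decompD[OF assms]
  have n: "dim_row A = n" using assms(2) by simp
  have "d i powr 1 = d i" if "i < n" for i using D(3)[OF that] by simp
  then have "real_diag n (\<lambda>i. d i powr 1) = real_diag n d"
    unfolding real_diag_def mat_diag_def by (intro eq_matI) auto
  then show ?thesis
    unfolding mat_powr_eq[OF assms(1)] n by (simp only: D(4)[symmetric])
qed

lemma mat_powr_zero:
  assumes "positive_spectral_decomp A U d" "A \<in> carrier_mat n n"
  shows "mat_powr A 0 = 1\<^sub>m n"
proof -
  note D = positive_spectral_decompD[OF assms]
  have n: "dim_row A = n" using assms(2) by simp
  \<comment> \<open>Positivity matters here, because \<open>0 powr 0 = 0\<close>.\<close>
  have "d i powr 0 = 1" if "i < n" for i using D(3)[OF that] by simp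
  then have "real_diag n (\<lambda>i. d i powr 0) = 1\<^sub>m n"
    unfolding real_diag_def mat_diag_def by (intro eq_matI) auto
  then show ?thesis
    unfolding mat_powr_eq[OF assms(1)] n
    by (simp only: right_mult_one_mat[OF D(1)] unitary_mat_right(2)[OF D(1,2)])
qed

section \<open>Summation of the scalar bounds over all pairs of eigenvalues\<close>

theorem theorem4p1:
  fixes n t :: nat and A B X :: "complex mat" and lam mu :: "nat \<Rightarrow> real" and \<nu> :: real
  assumes "n \<ge> 1"
    and "A \<in> carrier_mat n n" and "B \<in> carrier_mat n n" and "X \<in> carrier_mat n n"
    and "positive_definite A" and "positive_definite B"
    and "eigenvalues_with_mult n A lam" and "eigenvalues_with_mult n B mu"
    and "0 < \<nu>" and "\<nu> < 1"
    and "t \<ge> 1"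
  shows "let S =
    (hilbert_schmidt_norm (complex_of_real (1 - \<nu>) \<cdot>\<^sub>m (A * X) + complex_of_real \<nu> \<cdot>\<^sub>m (X * B)))\<^sup>2
    - (r_seq \<nu> 0)\<^sup>2 * (hilbert_schmidt_norm (A * X - X * B))\<^sup>2
    - (\<Sum>k = 1..t - 1. r_seq \<nu> k *
        (hilbert_schmidt_norm
          (mat_powr A (1 - m_seq \<nu> k / 2 ^ k) * X * mat_powr B (m_seq \<nu> k / 2 ^ k)
           - mat_powr A (1 - (m_seq \<nu> k + 1) / 2 ^ k) * X * mat_powr B ((m_seq \<nu> k + 1) / 2 ^ k)))\<^sup>2)
   in K_lower n lam mu \<nu> t * (hilbert_schmidt_norm (mat_powr A (1 - \<nu>) * X * mat_powr B \<nu>))\<^sup>2 \<le> S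
    \<and> S \<le> K_upper n lam mu \<nu> t * (hilbert_schmidt_norm (mat_powr A (1 - \<nu>) * X * mat_powr B \<nu>))\<^sup>2"
proof -
  obtain U where U: "U \<in> carrier_mat n n" and dU: "positive_spectral_decomp A U lam"
    using positive_definite_spectral_decomp assms(2,5,7) by blast
  obtain V where V: "V \<in> carrier_mat n n" and dV: "positive_spectral_decomp B V mu"
    using positive_definite_spectral_decomp assms(3,6,8) by blast
  note uU = positive_spectral_decompD(2)[OF dU assms(2)] and lam = positive_spectral_decompD(3)[OF dU assms(2)]
    and uV = positive_spectral_decompD(2)[OF dV assms(3)] and mu = positive_spectral_decompD(3)[OF dV assms(3)]
  have pw: "lam i powr 1 = lam i" "lam i powr 0 = 1" "mu i powr 1 = mu i" "mu i powr 0 = 1"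
    if "i < n" for i
    using lam[OF that] mu[OF that] by simp_all
  note X = assms(4)
  define y where "y i j = (cmod ((mat_adjoint U * X * V) $$ (i, j)))\<^sup>2" for i j
  let ?T = "spectral_multiplier U V X"
  note powr = mat_powr_mult_mat_powr[OF assms(2,3) X dU dV]
  note norm = spectral_multiplier_norm[OF U uU V uV X, folded y_def]
  note lin = spectral_multiplier_linear[OF U V X]
  note diff = spectral_multiplier_diff[OF U V X]
  \<comment> \<open>Reading the identity matrix as a zeroth power gives both one-sided products the
    same two-sided form as the other terms.\<close>
  have AX: "A * X = ?T (\<lambda>i j. lam i powr 1 * mu j powr 0)"
    using powr[of 1 0] mat_powr_one[OF dU assms(2)] mat_powr_zero[OF dV assms(3)] assms(2,3) X by simp
  have XB: "X * B = ?T (\<lambda>i j. lam i powr 0 * mu j powr 1)"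
    using powr[of 0 1] mat_powr_zero[OF dU assms(2)] mat_powr_one[OF dV assms(3)] assms(2,3) X by simp
  define s where "s i j = ((1 - \<nu>) * lam i + \<nu> * mu j)\<^sup>2 - (r_seq \<nu> 0)\<^sup>2 * (lam i - mu j)\<^sup>2
    - (\<Sum>k = 1..t - 1. r_seq \<nu> k * (dyadic_mean (lam i) (mu j) k (m_seq \<nu> k)
        - dyadic_mean (lam i) (mu j) k (m_seq \<nu> k + 1))\<^sup>2)" for i j
  define g where "g i j = (lam i powr (1 - \<nu>) * mu j powr \<nu>)\<^sup>2" for i j
  define h where "h i j = kantorovich2 ((mu j / lam i) powr (1 / 2 ^ (t - 1)))" for i j
  define G where "G = (hilbert_schmidt_norm (mat_powr A (1 - \<nu>) * X * mat_powr B \<nu>))\<^sup>2"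
  define S where "S =
    (hilbert_schmidt_norm (complex_of_real (1 - \<nu>) \<cdot>\<^sub>m (A * X) + complex_of_real \<nu> \<cdot>\<^sub>m (X * B)))\<^sup>2
    - (r_seq \<nu> 0)\<^sup>2 * (hilbert_schmidt_norm (A * X - X * B))\<^sup>2
    - (\<Sum>k = 1..t - 1. r_seq \<nu> k *
        (hilbert_schmidt_norm
          (mat_powr A (1 - m_seq \<nu> k / 2 ^ k) * X * mat_powr B (m_seq \<nu> k / 2 ^ k)
           - mat_powr A (1 - (m_seq \<nu> k + 1) / 2 ^ k) * X * mat_powr B ((m_seq \<nu> k + 1) / 2 ^ k)))\<^sup>2)"
  have G: "G = (\<Sum>i<n. \<Sum>j<n. g i j * y i j)"
    unfolding G_def powr norm g_def ..
  have e1: "(\<Sum>k = 1..t - 1. r_seq \<nu> k * (\<Sum>i<n. \<Sum>j<n. (dyadic_mean (lam i) (mu j) k (m_seq \<nu> k)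
        - dyadic_mean (lam i) (mu j) k (m_seq \<nu> k + 1))\<^sup>2 * y i j))
    = (\<Sum>i<n. \<Sum>j<n. (\<Sum>k = 1..t - 1. r_seq \<nu> k * (dyadic_mean (lam i) (mu j) k (m_seq \<nu> k)
        - dyadic_mean (lam i) (mu j) k (m_seq \<nu> k + 1))\<^sup>2) * y i j)"
    unfolding sum_distrib_left sum_distrib_right mult.assoc
    by (subst sum.swap, rule sum.cong[OF refl], rule sum.swap)
  \<comment> \<open>The exponents 0 and 1 are simplified under the sums, where the index bounds
    supply positivity of the eigenvalues.\<close>
  have e2: "(\<Sum>i<n. \<Sum>j<n. ((1 - \<nu>) * (lam i powr 1 * mu j powr 0)
      + \<nu> * (lam i powr 0 * mu j powr 1))\<^sup>2 * y i j)
    = (\<Sum>i<n. \<Sum>j<n. ((1 - \<nu>) * lam i + \<nu> * mu j)\<^sup>2 * y i j)"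
    by (intro sum.cong refl) (simp only: pw lessThan_iff mult_1_left mult_1_right)
  have e3: "(\<Sum>i<n. \<Sum>j<n. (lam i powr 1 * mu j powr 0 - lam i powr 0 * mu j powr 1)\<^sup>2 * y i j)
    = (\<Sum>i<n. \<Sum>j<n. (lam i - mu j)\<^sup>2 * y i j)"
    by (intro sum.cong refl) (simp only: pw lessThan_iff mult_1_left mult_1_right)
  have S: "S = (\<Sum>i<n. \<Sum>j<n. s i j * y i j)"
    unfolding S_def AX XB powr lin diff norm dyadic_mean_def[symmetric] e1 e2 e3
    by (simp only: s_def left_diff_distrib sum_subtractf sum_distrib_left mult.assoc)
  have y: "y i j \<ge> 0" for i j unfolding y_def by simp
  have g: "g i j \<ge> 0" for i j unfolding g_def by simp
  let ?L = "{h i j powr r_seq \<nu> t | i j. i < n \<and> j < n}"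
  let ?R = "{h i j powr R_seq \<nu> t | i j. i < n \<and> j < n}"
  \<comment> \<open>As images of a finite index set both sets are finite, which
    \<open>Min_le\<close> and \<open>Max_ge\<close> require.\<close>
  have "?L = (\<lambda>(i, j). h i j powr r_seq \<nu> t) ` ({..<n} \<times> {..<n})"
    and "?R = (\<lambda>(i, j). h i j powr R_seq \<nu> t) ` ({..<n} \<times> {..<n})" by auto
  then have fin: "finite ?L" "finite ?R" by simp_all
  have lower: "K_lower n lam mu \<nu> t * g i j \<le> s i j" if "i < n" "j < n" for i j
  proof -
    have "K_lower n lam mu \<nu> t \<le> h i j powr r_seq \<nu> t"
      using fin(1) that unfolding K_lower_def h_def[symmetric] by (intro Min_le) auto
    then have "K_lower n lam mu \<nu> t * g i j \<le> h i j powr r_seq \<nu> t * g i j"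
      using g by (rule mult_right_mono)
    also have "\<dots> \<le> s i j"
      using young_kantorovich_dyadic(1)[OF lam[OF that(1)] mu[OF that(2)] assms(9-11)]
      unfolding s_def g_def h_def .
    finally show ?thesis .
  qed
  have upper: "s i j \<le> K_upper n lam mu \<nu> t * g i j" if "i < n" "j < n" for i j
  proof -
    have "h i j powr R_seq \<nu> t \<le> K_upper n lam mu \<nu> t"
      using fin(2) that unfolding K_upper_def h_def[symmetric] by (intro Max_ge) auto
    then have "h i j powr R_seq \<nu> t * g i j \<le> K_upper n lam mu \<nu> t * g i j"
      using g by (rule mult_right_mono)
    moreover have "s i j \<le> h i j powr R_seq \<nu> t * g i j"
      using young_kantorovich_dyadic(2)[OF lam[OF that(1)] mu[OF that(2)] assms(9-11)]
      unfolding s_def g_def h_def .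
    ultimately show ?thesis by simp
  qed
  \<comment> \<open>The extremal constants do not depend on the pair, so they factor out of the sum
    with nonnegative weights \<open>y i j\<close>.\<close>
  have "K_lower n lam mu \<nu> t * G \<le> S"
    unfolding G S sum_distrib_left mult.assoc[symmetric]
    by (intro sum_mono mult_right_mono lower y) simp_all
  moreover have "S \<le> K_upper n lam mu \<nu> t * G"
    unfolding G S sum_distrib_left mult.assoc[symmetric]
    by (intro sum_mono mult_right_mono upper y) simp_all
  ultimately show ?thesis unfolding Let_def S_def[symmetric] G_def[symmetric] by (rule conjI)
qed

end
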